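(* Let $(Q,\cdot)$ be a quadratical quasigroup of finite order $n$. Then $(Q,\cdot)$ is $k$-translatable (for some positive integer $k$, with respect to some ordering of $Q$) if and only if it is induced by the additive group $\mathbb{Z}_n$.
   Context: A quasigroup is a set with a binary operation such that for all $a,b$ the equations $ax=b$ and $xa=b$ each have a unique solution $x$. A quadratical quasigroup is a quasigroup satisfying $(x\cdot y)\cdot x=(z\cdot x)\cdot(y\cdot z)$. An ordering of $Q$ is a bijective labelling $Q=\{q_1,\ldots,q_n\}$ (identified with $1,\ldots,n$); $(Q,\cdot)$ is $k$-translatable with respect to this ordering if $q_i\cdot q_j=q_{[i+1]_n}\cdot q_{[j+k]_n}$ for all $i,j\in\{1,\ldots,n\}$, where $[m]_n\in\{1,\ldots,n\}$ is the residue of $m$ modulo $n$ (with $0=n$). $(Q,\cdot)$ is induced by the group $\mathbb{Z}_n$ if there is a commutative group structure $(Q,+)$ on $Q$ isomorphic to the additive group $\mathbb{Z}_n$ of integers modulo $n$, with two commuting automorphisms $\rho,\lambda$ of $(Q,+)$ such that $x\cdot y=\rho x+\lambda y$ for all $x,y\in Q$. *)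

theory Defs
  imports "HOL-Algebra.Elementary_Groups"
begin

text \<open>Quasigroups are taken to be nonempty, as usual; the empty set has no ordering
  \<open>q\<^sub>1, \<dots>, q\<^sub>n\<close> with \<open>n \<ge> 1\<close> and carries no group structure.\<close>

locale quasigroup =
  fixes Q :: "'a set" and op :: "'a \<Rightarrow> 'a \<Rightarrow> 'a" (infixl \<open>\<cdot>\<close> 70)
  assumes nonempty: "Q \<noteq> {}"
    and closed: "\<And>x y. x \<in> Q \<Longrightarrow> y \<in> Q \<Longrightarrow> x \<cdot> y \<in> Q"
    and left_division: "\<And>a b. a \<in> Q \<Longrightarrow> b \<in> Q \<Longrightarrow> \<exists>!x\<in>Q. a \<cdot> x = b"
    and right_division: "\<And>a b. a \<in> Q \<Longrightarrow> b \<in> Q \<Longrightarrow> \<exists>!x\<in>Q. x \<cdot> a = b"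

locale quadratical_quasigroup = quasigroup +
  assumes quadratical:
    "\<And>x y z. x \<in> Q \<Longrightarrow> y \<in> Q \<Longrightarrow> z \<in> Q \<Longrightarrow> (x \<cdot> y) \<cdot> x = (z \<cdot> x) \<cdot> (y \<cdot> z)"

text \<open>The residue of \<open>m\<close> modulo \<open>n\<close> in \<open>{1..n}\<close>, with \<open>n\<close> in place of \<open>0\<close>.\<close>

definition residue1 :: "nat \<Rightarrow> nat \<Rightarrow> nat" where
  "residue1 n m = (if m mod n = 0 then n else m mod n)"

definition is_ordering :: "'a set \<Rightarrow> (nat \<Rightarrow> 'a) \<Rightarrow> bool" where
  "is_ordering Q q \<longleftrightarrow> bij_betw q {1..card Q} Q"

definition translatable_wrt ::
    "'a set \<Rightarrow> ('a \<Rightarrow> 'a \<Rightarrow> 'a) \<Rightarrow> (nat \<Rightarrow> 'a) \<Rightarrow> nat \<Rightarrow> bool" where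
  "translatable_wrt Q op q k \<longleftrightarrow>
     (\<forall>i\<in>{1..card Q}. \<forall>j\<in>{1..card Q}.
        op (q i) (q j) = op (q (residue1 (card Q) (i + 1))) (q (residue1 (card Q) (j + k))))"

text \<open>Only \<open>n \<ge> 1\<close> is of interest: \<^term>\<open>integer_mod_group 0\<close> is the group of integers.
  Membership in \<^term>\<open>iso G G\<close> says that a map restricts to an automorphism of \<open>G\<close>.\<close>

definition induced_by_integer_mod_group ::
    "'a set \<Rightarrow> ('a \<Rightarrow> 'a \<Rightarrow> 'a) \<Rightarrow> nat \<Rightarrow> bool" where
  "induced_by_integer_mod_group Q op n \<longleftrightarrow>
     (\<exists>G :: 'a monoid. comm_group G \<and> carrier G = Q \<and> G \<cong> integer_mod_group n \<and>
        (\<exists>\<rho>\<in>iso G G. \<exists>\<mu>\<in>iso G G.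
           (\<forall>x\<in>Q. \<rho> (\<mu> x) = \<mu> (\<rho> x)) \<and>
           (\<forall>x\<in>Q. \<forall>y\<in>Q. op x y = \<rho> x \<otimes>\<^bsub>G\<^esub> \<mu> y)))"

end

theory Submission imports Defs "HOL-Number_Theory.Cong" begin

text \<open>Index \<open>Q\<close> by the residues modulo \<open>n\<close>. Translatability says that \<open>i \<cdot> j\<close> depends only on
  \<open>j - k * i\<close>, say \<open>i \<cdot> j = f (j - k * i)\<close>. The quadratical law forces \<open>x \<cdot> x = x\<close>, so
  \<open>f ((1 - k) * x) = x\<close>; hence \<open>1 - k\<close> is a unit modulo \<open>n\<close> and \<open>f\<close> is multiplication by its inverse,
  which makes the operation linear. Conversely, if \<open>x \<cdot> y = \<rho> x + \<mu> y\<close> over the integers modulo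
  \<open>n\<close>, any \<open>k\<close> with \<open>\<rho> 1 + \<mu> k = 0\<close> makes the natural ordering \<open>k\<close>-translatable.\<close>

section \<open>Orderings as indexings by residues modulo \<open>n\<close>\<close>

text \<open>This encodes a bijection from Z/n onto \<open>Q\<close> as a periodic function on all
  integers, so that index arithmetic needs no explicit reduction.\<close>

definition cyclic_indexing :: "nat \<Rightarrow> 'a set \<Rightarrow> (int \<Rightarrow> 'a) \<Rightarrow> bool" where
  "cyclic_indexing n Q \<phi> \<longleftrightarrow>
     range \<phi> = Q \<and> (\<forall>i j. \<phi> i = \<phi> j \<longleftrightarrow> [i = j] (mod int n))"

lemma residue1_range: "0 < n \<Longrightarrow> residue1 n m \<in> {1..n}"
  by (simp add: residue1_def Suc_le_eq less_imp_le)

lemma residue1_cong: "[residue1 n m = m] (mod n)"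
  by (simp add: residue1_def cong_def)

lemma residue1_eq_iff:
  assumes "0 < n"
  shows "residue1 n a = residue1 n b \<longleftrightarrow> [a = b] (mod n)"
proof -
  \<comment> \<open>No remainder equals \<open>n\<close>, so sending remainder 0 to \<open>n\<close>
    causes no collision.\<close>
  have "a mod n \<noteq> n" "b mod n \<noteq> n"
    using mod_less_divisor[OF assms] less_irrefl by metis+
  then show ?thesis
    by (simp add: residue1_def cong_def)
qed

lemma residue1_id: "m \<in> {1..n} \<Longrightarrow> residue1 n m = m"
  by (cases "m = n") (auto simp: residue1_def)

lemma cyclic_indexing_eq:
  "cyclic_indexing n Q \<phi> \<Longrightarrow> \<phi> i = \<phi> j \<longleftrightarrow> [i = j] (mod int n)"
  by (simp add: cyclic_indexing_def)

lemma cyclic_indexing_mem: "cyclic_indexing n Q \<phi> \<Longrightarrow> \<phi> i \<in> Q"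
  by (auto simp: cyclic_indexing_def)

lemma cyclic_indexing_surj:
  assumes "cyclic_indexing n Q \<phi>" "x \<in> Q"
  obtains i where "x = \<phi> i"
  using assms by (auto simp: cyclic_indexing_def)

lemma cyclic_indexing_residue1:
  assumes "cyclic_indexing n Q \<phi>"
  shows "\<phi> (int (residue1 n m)) = \<phi> (int m)"
  using residue1_cong[of n m] by (simp add: cyclic_indexing_eq[OF assms] cong_int_iff)

lemma cyclic_indexing_nat:
  assumes "cyclic_indexing n Q \<phi>" "0 < n" "x \<in> Q"
  obtains m where "m \<in> {1..n}" "x = \<phi> (int m)"
proof -
  obtain i where i: "x = \<phi> i"
    using cyclic_indexing_surj[OF assms(1,3)] .
  have "[i = int (nat (i mod int n))] (mod int n)"
    using assms(2) by (simp add: cong_def)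
  \<comment> \<open>The remainder may be 0, which is not a label; \<open>residue1\<close> moves it
    to \<open>n\<close> within the same class.\<close>
  then have "x = \<phi> (int (residue1 n (nat (i mod int n))))"
    unfolding i cyclic_indexing_residue1[OF assms(1)] by (simp add: cyclic_indexing_eq[OF assms(1)])
  then show ?thesis
    using that residue1_range[OF assms(2)] by blast
qed

lemma cyclic_indexing_imp_ordering:
  assumes "cyclic_indexing (card Q) Q \<phi>" "0 < card Q"
  shows "is_ordering Q (\<lambda>m. \<phi> (int m))"
  unfolding is_ordering_def bij_betw_def
proof
  show "inj_on (\<lambda>m. \<phi> (int m)) {1..card Q}"
  proof (rule inj_onI)
    fix a b
    assume "a \<in> {1..card Q}" "b \<in> {1..card Q}" "\<phi> (int a) = \<phi> (int b)"
    then show "a = b"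
      using residue1_eq_iff[OF assms(2), of a b]
      by (simp add: residue1_id cyclic_indexing_eq[OF assms(1)] cong_int_iff)
  qed
  show "(\<lambda>m. \<phi> (int m)) ` {1..card Q} = Q"
    using cyclic_indexing_mem[OF assms(1)] cyclic_indexing_nat[OF assms] by blast
qed

text \<open>The labelling on \<open>{1..card Q}\<close> extends periodically to all
  integers.\<close>

lemma ordering_imp_cyclic_indexing:
  assumes "is_ordering Q q" "0 < card Q"
  obtains \<phi> where "cyclic_indexing (card Q) Q \<phi>" "\<And>m. m \<in> {1..card Q} \<Longrightarrow> \<phi> (int m) = q m"
proof
  let ?n = "card Q"
  define \<phi> where "\<phi> i = q (residue1 ?n (nat (i mod int ?n)))" for i
  have inj: "inj_on q {1..?n}" and img: "q ` {1..?n} = Q"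
    using assms(1) by (simp_all add: is_ordering_def bij_betw_def)
  have eq: "\<phi> i = \<phi> j \<longleftrightarrow> [i = j] (mod int ?n)" for i j
  proof -
    have "\<phi> i = \<phi> j \<longleftrightarrow> [nat (i mod int ?n) = nat (j mod int ?n)] (mod ?n)"
      unfolding \<phi>_def residue1_eq_iff[OF assms(2), symmetric]
      using inj residue1_range[OF assms(2)] by (simp add: inj_on_eq_iff)
    also have "\<dots> \<longleftrightarrow> [i mod int ?n = j mod int ?n] (mod int ?n)"
      using assms(2) by (simp flip: cong_int_iff)
    finally show ?thesis
      by (simp add: cong_def)
  qed
  show q: "\<phi> (int m) = q m" if "m \<in> {1..?n}" for m
    \<comment> \<open>The delicate case is \<open>m = card Q\<close>: its remainder is 0, which
      \<open>residue1\<close> sends back to \<open>card Q\<close>.\<close>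
    using that residue1_eq_iff[OF assms(2), of "m mod ?n" m]
    by (simp add: \<phi>_def nat_int residue1_id cong_def flip: zmod_int)
  have "range \<phi> \<subseteq> Q"
    using img residue1_range[OF assms(2)] by (auto simp: \<phi>_def)
  moreover have "q ` {1..?n} \<subseteq> range \<phi>"
    using q[symmetric] by (intro image_subsetI) simp
  ultimately show "cyclic_indexing ?n Q \<phi>"
    using eq img by (simp add: subset_antisym cyclic_indexing_def)
qed

text \<open>Both sides of the defining equation depend only on the classes of the two indices, so
  wrap-around addition of labels becomes plain integer addition.\<close>

lemma translatable_wrt_cyclic_indexing:
  assumes \<phi>: "cyclic_indexing (card Q) Q \<phi>" and n: "0 < card Q"
    and q: "\<And>m. m \<in> {1..card Q} \<Longrightarrow> q m = \<phi> (int m)"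
  shows "translatable_wrt Q op q k \<longleftrightarrow>
    (\<forall>i j. op (\<phi> i) (\<phi> j) = op (\<phi> (i + 1)) (\<phi> (j + int k)))"
    (is "?T \<longleftrightarrow> ?R")
proof -
  have step: "q (residue1 (card Q) m) = \<phi> (int m)" for m
    using q[OF residue1_range[OF n]] cyclic_indexing_residue1[OF \<phi>] by simp
  show ?thesis
  proof
    assume ?T
    show ?R
    proof (intro allI)
      fix i j
      obtain a b where a: "a \<in> {1..card Q}" "\<phi> i = \<phi> (int a)"
        and b: "b \<in> {1..card Q}" "\<phi> j = \<phi> (int b)"
        using cyclic_indexing_nat[OF \<phi> n] cyclic_indexing_mem[OF \<phi>] by metis
      have "\<phi> (i + 1) = \<phi> (int (a + 1))" "\<phi> (j + int k) = \<phi> (int (b + k))"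
        using a(2) b(2) by (simp_all add: cyclic_indexing_eq[OF \<phi>] cong_add add.commute[of 1])
      then show "op (\<phi> i) (\<phi> j) = op (\<phi> (i + 1)) (\<phi> (j + int k))"
        using \<open>?T\<close> a b q unfolding translatable_wrt_def by (metis step)
    qed
  next
    assume ?R
    then show ?T
      unfolding translatable_wrt_def using q by (simp add: step add.commute[of 1])
  qed
qed

section \<open>Linearity of translatable quadratical operations\<close>

text \<open>Setting all three variables equal in the quadratical law leaves
  \<open>x \<cdot> x\<close> as a common left factor, which cancels.\<close>

lemma (in quadratical_quasigroup) idempotent:
  assumes "x \<in> Q"
  shows "x \<cdot> x = x"
proof -
  have "(x \<cdot> x) \<cdot> x = (x \<cdot> x) \<cdot> (x \<cdot> x)"
    by (rule quadratical[OF assms assms assms])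
  then show ?thesis
    using left_division[OF closed[OF assms assms] closed[OF closed[OF assms assms] assms]]
      closed[OF assms assms] assms by metis
qed

text \<open>Besides cancellation, this and its mirror image supply the bijectivity of the two
  automorphisms built later as translations by \<open>\<phi> 0\<close>.\<close>

lemma (in quasigroup) bij_betw_left:
  assumes "a \<in> Q"
  shows "bij_betw (\<lambda>x. a \<cdot> x) Q Q"
  unfolding bij_betw_def inj_on_def image_def
  using left_division[OF assms] closed[OF assms] by (auto, metis+)

lemma (in quasigroup) bij_betw_right:
  assumes "a \<in> Q"
  shows "bij_betw (\<lambda>x. x \<cdot> a) Q Q"
  unfolding bij_betw_def inj_on_def image_def
  using right_division[OF assms] closed[OF _ assms] by (auto, metis+)

lemma (in quadratical_quasigroup) translation_imp_linear:
  assumes \<phi>: "cyclic_indexing n Q \<phi>"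
    and shift: "\<And>i j. \<phi> i \<cdot> \<phi> j = \<phi> (i + 1) \<cdot> \<phi> (j + k)"
  obtains u where "\<And>i j. \<phi> i \<cdot> \<phi> j = \<phi> (u * (j - k * i))"
proof -
  note eq = cyclic_indexing_eq[OF \<phi>] and mem = cyclic_indexing_mem[OF \<phi>]
  \<comment> \<open>Each unit by which the first index moves towards 0 is paid for by
    \<open>k\<close> in the second; integer indices require induction in both directions.\<close>
  have shift0: "\<phi> i \<cdot> \<phi> j = \<phi> 0 \<cdot> \<phi> (j - k * i)" for i j
  proof (induction i arbitrary: j rule: int_induct[where k = 0])
    case (step1 i)
    then show ?case
      using shift[of i "j - k"] by (simp add: algebra_simps)
  next
    case (step2 i)
    then show ?case
      using shift[of "i - 1" j] by (simp add: algebra_simps)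
  qed simp
  \<comment> \<open>Equal indices turn \<open>shift0\<close> into a statement about squares, which
    idempotence evaluates.\<close>
  have diag: "\<phi> 0 \<cdot> \<phi> ((1 - k) * i) = \<phi> i" for i
    using shift0[of i i] idempotent[OF mem] by (simp add: algebra_simps)
  \<comment> \<open>This \<open>u\<close> is the value of f at 1. By \<open>diag\<close>, f takes
    the same value at \<open>(1 - k) * u\<close>, so cancelling \<open>\<phi> 0\<close> makes
    \<open>u\<close> an inverse of \<open>1 - k\<close>.\<close>
  have "\<exists>u. \<phi> 0 \<cdot> \<phi> 1 = \<phi> u"
    using cyclic_indexing_surj[OF \<phi>] closed mem by metis
  then obtain u where "\<phi> 0 \<cdot> \<phi> 1 = \<phi> u"
    by blast
  then have "\<phi> 0 \<cdot> \<phi> ((1 - k) * u) = \<phi> 0 \<cdot> \<phi> 1"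
    by (simp add: diag)
  then have "\<phi> ((1 - k) * u) = \<phi> 1"
    using bij_betw_left[OF mem] mem by (metis bij_betw_def inj_on_eq_iff)
  then have "[(1 - k) * u = 1] (mod int n)"
    by (simp add: eq)
  then have "[(1 - k) * u * t = 1 * t] (mod int n)" for t
    by (rule cong_scalar_right)
  \<comment> \<open>Every index is now a multiple of \<open>1 - k\<close>, so \<open>diag\<close>
    evaluates f everywhere.\<close>
  then have "\<phi> t = \<phi> ((1 - k) * (u * t))" for t
    by (simp add: eq mult.assoc cong_sym)
  then have "\<phi> i \<cdot> \<phi> j = \<phi> (u * (j - k * i))" for i j
    using shift0 diag by metis
  then show ?thesis
    using that by blast
qed

section \<open>Cyclic groups and indexings\<close>

lemma cyclic_indexing_group:
  assumes \<phi>: "cyclic_indexing n Q \<phi>" and n: "0 < n"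
  obtains G :: "'a monoid" where "comm_group G" "carrier G = Q" "\<phi> \<in> iso (integer_mod_group n) G"
    "\<And>i j. \<phi> i \<otimes>\<^bsub>G\<^esub> \<phi> j = \<phi> (i + j)"
proof
  note eq = cyclic_indexing_eq[OF \<phi>] and mem = cyclic_indexing_mem[OF \<phi>]
  \<comment> \<open>An arbitrary choice of preimages: they are determined only modulo
    \<open>n\<close>, which suffices because \<open>\<phi>\<close> is periodic.\<close>
  define \<psi> where "\<psi> = inv_into UNIV \<phi>"
  have \<psi>: "[\<psi> (\<phi> i) = i] (mod int n)" for i
    unfolding eq[symmetric] \<psi>_def by (simp add: f_inv_into_f)
  define G :: "'a monoid"
    where "G = \<lparr>carrier = Q, monoid.mult = (\<lambda>x y. \<phi> (\<psi> x + \<psi> y)), one = \<phi> 0\<rparr>"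
  show mult: "\<phi> i \<otimes>\<^bsub>G\<^esub> \<phi> j = \<phi> (i + j)" for i j
    by (simp add: G_def eq cong_add \<psi>)
  show carrier: "carrier G = Q"
    by (simp add: G_def)
  have one: "\<one>\<^bsub>G\<^esub> = \<phi> 0"
    by (simp add: G_def)
  have range: "carrier G = range \<phi>"
    using \<phi> by (simp add: G_def cyclic_indexing_def)
  show "comm_group G"
  proof (rule comm_groupI)
    fix x
    assume "x \<in> carrier G"
    then obtain i where "x = \<phi> i"
      using range by blast
    then have "\<phi> (- i) \<otimes>\<^bsub>G\<^esub> x = \<one>\<^bsub>G\<^esub>"
      by (simp add: mult one)
    then show "\<exists>y\<in>carrier G. y \<otimes>\<^bsub>G\<^esub> x = \<one>\<^bsub>G\<^esub>"
      using range by blast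
  qed (auto simp: range mult one add_ac)
  show "\<phi> \<in> iso (integer_mod_group n) G"
  proof (rule isoI)
    have "\<phi> ((i + j) mod int n) = \<phi> (i + j)" for i j
      by (simp add: eq cong_def)
    then show "\<phi> \<in> hom (integer_mod_group n) G"
      using n by (intro homI)
        (auto simp: range mult carrier_integer_mod_group mult_integer_mod_group)
    have "inj_on \<phi> {0..<int n}"
      by (auto simp: inj_on_def eq cong_def)
    moreover have "range \<phi> \<subseteq> \<phi> ` {0..<int n}"
    proof (rule image_subsetI)
      show "\<phi> i \<in> \<phi> ` {0..<int n}" for i
        using n by (intro image_eqI[where x = "i mod int n"]) (simp_all add: eq cong_def)
    qed
    ultimately have "bij_betw \<phi> {0..<int n} (range \<phi>)"
      unfolding bij_betw_def by blast
    then show "bij_betw \<phi> (carrier (integer_mod_group n)) (carrier G)"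
      using n by (simp add: range carrier_integer_mod_group)
  qed
qed

text \<open>Precomposing the isomorphism with reduction modulo \<open>n\<close> gives an additive
  map defined on all integers.\<close>

lemma iso_integer_mod_group_imp_cyclic_indexing:
  assumes h: "h \<in> iso (integer_mod_group n) G" and n: "0 < n"
  obtains \<phi> where "cyclic_indexing n (carrier G) \<phi>"
    "\<And>i j. \<phi> (i + j) = \<phi> i \<otimes>\<^bsub>G\<^esub> \<phi> j"
proof
  define \<phi> where "\<phi> i = h (i mod int n)" for i
  have carrier: "carrier (integer_mod_group n) = {0..<int n}"
    using n by (simp add: carrier_integer_mod_group)
  have bij: "bij_betw h {0..<int n} (carrier G)"
    using h by (simp add: iso_def carrier)
  have "range (\<lambda>i. i mod int n) = {0..<int n}"
  proof
    show "{0..<int n} \<subseteq> range (\<lambda>i. i mod int n)"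
      by (rule subsetI, rule range_eqI, rule mod_pos_pos_trivial[symmetric]) simp_all
  qed (use n in auto)
  then have "h ` {0..<int n} = range \<phi>"
    unfolding \<phi>_def by (metis image_image)
  then have "range \<phi> = carrier G"
    using bij by (simp add: bij_betw_def)
  moreover have "\<phi> i = \<phi> j \<longleftrightarrow> [i = j] (mod int n)" for i j
    using inj_on_eq_iff[OF bij_betw_imp_inj_on[OF bij], of "i mod int n" "j mod int n"] n
    by (simp add: \<phi>_def cong_def)
  ultimately show "cyclic_indexing n (carrier G) \<phi>"
    by (simp add: cyclic_indexing_def)
  show "\<phi> (i + j) = \<phi> i \<otimes>\<^bsub>G\<^esub> \<phi> j" for i j
  proof -
    have "h ((i mod int n) \<otimes>\<^bsub>integer_mod_group n\<^esub> (j mod int n)) = \<phi> i \<otimes>\<^bsub>G\<^esub> \<phi> j"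
      unfolding \<phi>_def using n by (intro hom_mult[OF iso_imp_homomorphism[OF h]]) (simp_all add: carrier)
    then show ?thesis
      using n by (simp add: \<phi>_def mult_integer_mod_group mod_simps)
  qed
qed

section \<open>The two implications\<close>

lemma (in quadratical_quasigroup) translatable_imp_induced:
  assumes n: "0 < card Q" and q: "is_ordering Q q" and trans: "translatable_wrt Q (\<cdot>) q k"
  shows "induced_by_integer_mod_group Q (\<cdot>) (card Q)"
proof -
  obtain \<phi> where \<phi>: "cyclic_indexing (card Q) Q \<phi>"
    and \<phi>q: "\<And>m. m \<in> {1..card Q} \<Longrightarrow> \<phi> (int m) = q m"
    using ordering_imp_cyclic_indexing[OF q n] by blast
  note mem = cyclic_indexing_mem[OF \<phi>]
  have "\<phi> i \<cdot> \<phi> j = \<phi> (i + 1) \<cdot> \<phi> (j + int k)" for i j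
    using trans translatable_wrt_cyclic_indexing[OF \<phi> n \<phi>q[symmetric]] by blast
  then obtain u where op: "\<And>i j. \<phi> i \<cdot> \<phi> j = \<phi> (u * (j - int k * i))"
    using translation_imp_linear[OF \<phi>, of "int k"] by blast
  obtain G :: "'a monoid" where G: "comm_group G" "carrier G = Q" "\<phi> \<in> iso (integer_mod_group (card Q)) G"
    and mult: "\<And>i j. \<phi> i \<otimes>\<^bsub>G\<^esub> \<phi> j = \<phi> (i + j)"
    using cyclic_indexing_group[OF \<phi> n] by blast
  have ran: "Q = range \<phi>"
    using \<phi> by (simp add: cyclic_indexing_def)
  \<comment> \<open>Since \<open>\<phi> 0\<close> is the zero of \<open>G\<close>, on indices
    \<open>\<rho>\<close> is multiplication by \<open>- u * k\<close> and \<open>\<mu>\<close> by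
    \<open>u\<close>. Defining both as translations yields bijectivity from the quasigroup
    axioms.\<close>
  define \<rho> where "\<rho> x = x \<cdot> \<phi> 0" for x
  define \<mu> where "\<mu> x = \<phi> 0 \<cdot> x" for x
  have "\<rho> \<in> iso G G"
    unfolding \<rho>_def using bij_betw_right[OF mem, of 0]
    by (intro isoI homI) (auto simp: G(2) ran op mult algebra_simps)
  moreover have "\<mu> \<in> iso G G"
    unfolding \<mu>_def using bij_betw_left[OF mem, of 0]
    by (intro isoI homI) (auto simp: G(2) ran op mult algebra_simps)
  moreover have "\<forall>x\<in>Q. \<rho> (\<mu> x) = \<mu> (\<rho> x)"
    by (auto simp: ran \<rho>_def \<mu>_def op algebra_simps)
  moreover have "\<forall>x\<in>Q. \<forall>y\<in>Q. x \<cdot> y = \<rho> x \<otimes>\<^bsub>G\<^esub> \<mu> y"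
    by (auto simp: ran \<rho>_def \<mu>_def op mult algebra_simps)
  moreover have "G \<cong> integer_mod_group (card Q)"
    using group.iso_sym[OF group_integer_mod_group] G(3) by (auto simp: is_iso_def)
  ultimately show ?thesis
    using G(1,2) unfolding induced_by_integer_mod_group_def
    by (intro exI[of _ G] conjI bexI[of _ \<rho>] bexI[of _ \<mu>])
qed

lemma induced_imp_translatable:
  assumes n: "0 < card Q" and ind: "induced_by_integer_mod_group Q op (card Q)"
  shows "\<exists>k>0. \<exists>q. is_ordering Q q \<and> translatable_wrt Q op q k"
proof -
  obtain G :: "'a monoid" and \<rho> \<mu> where "comm_group G" and carrier: "carrier G = Q"
    and iso: "G \<cong> integer_mod_group (card Q)"
    and \<rho>: "\<rho> \<in> iso G G" and \<mu>: "\<mu> \<in> iso G G"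
    and op: "\<And>x y. x \<in> Q \<Longrightarrow> y \<in> Q \<Longrightarrow> op x y = \<rho> x \<otimes>\<^bsub>G\<^esub> \<mu> y"
    using ind unfolding induced_by_integer_mod_group_def by blast
  interpret comm_group G by fact
  obtain h where "h \<in> iso (integer_mod_group (card Q)) G"
    using iso_sym iso by (auto simp: is_iso_def)
  then obtain \<phi> where \<phi>: "cyclic_indexing (card Q) Q \<phi>"
    and add: "\<And>i j. \<phi> (i + j) = \<phi> i \<otimes>\<^bsub>G\<^esub> \<phi> j"
    using iso_integer_mod_group_imp_cyclic_indexing[OF _ n] carrier by metis
  have mem: "\<phi> i \<in> carrier G" for i
    using cyclic_indexing_mem[OF \<phi>] carrier by simp
  have \<rho>mem: "\<rho> x \<in> carrier G" and \<mu>mem: "\<mu> x \<in> carrier G" if "x \<in> carrier G" for x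
    using that \<rho> \<mu> by (auto simp: iso_def hom_def)
  \<comment> \<open>Surjectivity of \<open>\<mu>\<close> makes \<open>\<rho> 1 + \<mu> k = 0\<close>
    solvable for \<open>k\<close>.\<close>
  have "inv\<^bsub>G\<^esub> (\<rho> (\<phi> 1)) \<in> \<mu> ` carrier G"
    using \<mu> \<rho>mem mem by (simp add: iso_def bij_betw_def)
  \<comment> \<open>Choosing the representative in \<open>{1..card Q}\<close> rather than from 0
    guarantees a positive \<open>k\<close>.\<close>
  then obtain k where k: "k \<in> {1..card Q}" "\<mu> (\<phi> (int k)) = inv\<^bsub>G\<^esub> (\<rho> (\<phi> 1))"
    using cyclic_indexing_nat[OF \<phi> n] carrier by (metis imageE)
  have "op (\<phi> i) (\<phi> j) = op (\<phi> (i + 1)) (\<phi> (j + int k))" for i j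
  proof -
    have "op (\<phi> (i + 1)) (\<phi> (j + int k)) =
      (\<rho> (\<phi> i) \<otimes>\<^bsub>G\<^esub> \<rho> (\<phi> 1)) \<otimes>\<^bsub>G\<^esub> (\<mu> (\<phi> j) \<otimes>\<^bsub>G\<^esub> \<mu> (\<phi> (int k)))"
      unfolding op[OF cyclic_indexing_mem[OF \<phi>] cyclic_indexing_mem[OF \<phi>]] unfolding add
      using mem hom_mult[OF iso_imp_homomorphism[OF \<rho>]] hom_mult[OF iso_imp_homomorphism[OF \<mu>]]
      by simp
    \<comment> \<open>Commutativity of \<open>G\<close> brings the two increments together, where
      they cancel.\<close>
    also have "\<dots> = (\<rho> (\<phi> i) \<otimes>\<^bsub>G\<^esub> \<mu> (\<phi> j)) \<otimes>\<^bsub>G\<^esub> (\<rho> (\<phi> 1) \<otimes>\<^bsub>G\<^esub> inv\<^bsub>G\<^esub> (\<rho> (\<phi> 1)))"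
      unfolding k(2)[symmetric] using mem \<rho>mem \<mu>mem by (simp add: m_ac)
    also have "\<dots> = op (\<phi> i) (\<phi> j)"
      using mem \<rho>mem \<mu>mem by (simp add: op cyclic_indexing_mem[OF \<phi>])
    finally show ?thesis ..
  qed
  then have "translatable_wrt Q op (\<lambda>m. \<phi> (int m)) k"
    using translatable_wrt_cyclic_indexing[OF \<phi> n] by simp
  moreover have "0 < k"
    using k(1) by simp
  ultimately show ?thesis
    using cyclic_indexing_imp_ordering[OF \<phi> n] by blast
qed

theorem theorem3p7:
  fixes Q :: "'a set" and op :: "'a \<Rightarrow> 'a \<Rightarrow> 'a" and n :: nat
  assumes "quadratical_quasigroup Q op" and "finite Q" and "card Q = n"
  shows "(\<exists>k>0. \<exists>q. is_ordering Q q \<and> translatable_wrt Q op q k) \<longleftrightarrow>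
         induced_by_integer_mod_group Q op n"
proof -
  interpret quadratical_quasigroup Q op
    by fact
  \<comment> \<open>Positivity excludes \<open>integer_mod_group 0\<close>, the infinite group of
    integers.\<close>
  have n: "0 < card Q"
    using assms(2) nonempty by (simp add: card_gt_0_iff)
  show ?thesis
    using translatable_imp_induced[OF n] induced_imp_translatable[OF n] assms(3) by blast
qed

end
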